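(* For every integer $k$, every finite set of at least $\mathrm{ES}(k)$ points in the plane (not necessarily in general position) contains $k$ points in convex position.
   Context: A finite set $P$ of points in the plane is in general position if no three points of $P$ are collinear. $P$ is in convex position if every point of $P$ is on the boundary of its convex hull $\mathrm{conv}(P)$ (this is the non-strict notion: for example, any finite set of collinear points is in convex position). For an integer $k$, $\mathrm{ES}(k)$ denotes the minimum nonnegative integer such that every finite set of at least $\mathrm{ES}(k)$ points in general position in the plane contains $k$ points in convex position (it exists by the Erdős–Szekeres Theorem). Containing $k$ points in convex position means having a subset of at least $k$ points that is in convex position. *)

theory Defs
  imports "HOL-Analysis.Analysis"
begin

definition general_position :: "(real^2) set \<Rightarrow> bool" where
  "general_position P \<longleftrightarrow>
     (\<forall>a\<in>P. \<forall>b\<in>P. \<forall>c\<in>P. a \<noteq> b \<and> a \<noteq> c \<and> b \<noteq> c \<longrightarrow> \<not> collinear {a, b, c})"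

text \<open>The boundary is the topological boundary in the plane, not the relative one, so this is
  the non-strict notion: every finite set of collinear points is in convex position.\<close>

definition convex_position :: "(real^2) set \<Rightarrow> bool" where
  "convex_position P \<longleftrightarrow> P \<subseteq> frontier (convex hull P)"

definition contains_convex :: "int \<Rightarrow> (real^2) set \<Rightarrow> bool" where
  "contains_convex k P \<longleftrightarrow> (\<exists>Q\<subseteq>P. int (card Q) \<ge> k \<and> convex_position Q)"

text \<open>The minimum exists by the Erdos-Szekeres theorem, which is not built into the definition.\<close>

definition ES :: "int \<Rightarrow> nat" where
  "ES k = (LEAST n. \<forall>P. finite P \<and> general_position P \<and> card P \<ge> n \<longrightarrow> contains_convex k P)"

end

theory Submission
  imports "HOL-Library.Ramsey" Defs
begin

text \<open>Ramsey's theorem for triples, coloured by orientation, shows that \<open>ES k\<close> is attained. A finite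
  set \<open>P\<close> is a limit of injective images in general position, obtained by moving its points towards
  distinct points of a parabola. One subset of \<open>P\<close> of size at least \<open>k\<close> has its image in convex
  position infinitely often, and non-strict convex position survives limits since unit normals of
  supporting lines have a convergent subsequence.\<close>

section \<open>Convex position by supporting lines, and its limits\<close>

text \<open>A point of a convex set fails to be interior exactly when some line supports the set
  there, and a linear inequality on \<open>Q\<close> extends to its hull. Unit normals lie on a
  compact circle, which the limit argument exploits.\<close>

lemma convex_position_iff_support:
  "convex_position Q \<longleftrightarrow> (\<forall>q\<in>Q. \<exists>u. norm u = 1 \<and> (\<forall>x\<in>Q. u \<bullet> x \<le> u \<bullet> q))"
proof -
  have "q \<in> frontier (convex hull Q) \<longleftrightarrow> (\<exists>u. norm u = 1 \<and> (\<forall>x\<in>Q. u \<bullet> x \<le> u \<bullet> q))"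
    if q: "q \<in> Q" for q
  proof
    have qh: "q \<in> convex hull Q"
      using q by (rule hull_inc)
    assume "q \<in> frontier (convex hull Q)"
    then have ni: "q \<notin> interior (convex hull Q)"
      by (simp add: frontier_def)
    have "\<exists>a. a \<noteq> 0 \<and> (\<forall>x\<in>convex hull Q. a \<bullet> x \<le> a \<bullet> q)"
    \<comment> \<open>A hull without interior lies in a line, and the functional given by a normal
      of that line is constant on it.\<close>
    proof (cases "interior (convex hull Q) = {}")
      case True
      then obtain a b where "a \<noteq> 0" "convex hull Q \<subseteq> {x. a \<bullet> x = b}"
        using empty_interior_subset_hyperplane[OF convex_convex_hull] by metis
      with qh have "\<forall>x\<in>convex hull Q. a \<bullet> x \<le> a \<bullet> q"
        by (metis (mono_tags, lifting) mem_Collect_eq order_refl subsetD)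
      with \<open>a \<noteq> 0\<close> show ?thesis by blast
    next
      case False
      obtain a b where ab: "a \<noteq> 0" "\<forall>x\<in>interior (convex hull Q). a \<bullet> x \<le> b"
          "\<forall>x\<in>{q}. a \<bullet> x \<ge> b"
        using separating_hyperplane_sets[of "interior (convex hull Q)" "{q}"] False ni
        by (auto simp: convex_interior)
      \<comment> \<open>Separation bounds only the interior, but its closure contains the whole
        hull.\<close>
      have "closure (interior (convex hull Q)) \<subseteq> {x. a \<bullet> x \<le> b}"
        using ab(2) by (intro closure_minimal closed_halfspace_le) auto
      then have "convex hull Q \<subseteq> {x. a \<bullet> x \<le> b}"
        using convex_closure_interior[OF convex_convex_hull False] closure_subset by blast
      with ab show ?thesis by force
    qed
    then obtain a where a: "a \<noteq> 0" "\<forall>x\<in>convex hull Q. a \<bullet> x \<le> a \<bullet> q" by blast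
    have "\<forall>x\<in>Q. sgn a \<bullet> x \<le> sgn a \<bullet> q"
      using a by (auto simp: sgn_div_norm hull_inc divide_right_mono)
    then show "\<exists>u. norm u = 1 \<and> (\<forall>x\<in>Q. u \<bullet> x \<le> u \<bullet> q)"
      using a(1) norm_sgn by metis
  next
    assume "\<exists>u. norm u = 1 \<and> (\<forall>x\<in>Q. u \<bullet> x \<le> u \<bullet> q)"
    then obtain u where u: "norm u = 1" "\<forall>x\<in>Q. u \<bullet> x \<le> u \<bullet> q" by blast
    have "convex hull Q \<subseteq> {x. u \<bullet> x \<le> u \<bullet> q}"
      using u by (intro hull_minimal convex_halfspace_le) auto
    then have "interior (convex hull Q) \<subseteq> interior {x. u \<bullet> x \<le> u \<bullet> q}"
      by (rule interior_mono)
    also have "\<dots> = {x. u \<bullet> x < u \<bullet> q}"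
      using u(1) by (intro interior_halfspace_le) auto
    finally have "interior (convex hull Q) \<subseteq> {x. u \<bullet> x < u \<bullet> q}" .
    then have "q \<notin> interior (convex hull Q)" by auto
    moreover have "q \<in> closure (convex hull Q)"
      using q closure_subset hull_inc by fastforce
    ultimately show "q \<in> frontier (convex hull Q)"
      by (simp add: frontier_def)
  qed
  then show ?thesis
    by (auto simp: convex_position_def subset_iff)
qed

lemma convex_positionI:
  assumes "\<And>q. q \<in> Q \<Longrightarrow> \<exists>u. u \<noteq> 0 \<and> (\<forall>x\<in>Q. u \<bullet> x \<le> u \<bullet> q)"
  shows "convex_position Q"
  unfolding convex_position_iff_support
proof
  fix q assume "q \<in> Q"
  then obtain u where u: "u \<noteq> 0" "\<forall>x\<in>Q. u \<bullet> x \<le> u \<bullet> q" using assms by blast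
  then have "\<forall>x\<in>Q. sgn u \<bullet> x \<le> sgn u \<bullet> q"
    by (auto simp: sgn_div_norm divide_right_mono)
  then show "\<exists>u. norm u = 1 \<and> (\<forall>x\<in>Q. u \<bullet> x \<le> u \<bullet> q)"
    using u(1) norm_sgn by metis
qed

text \<open>Only weak inequalities survive the limit, so vertices of the images may end up inside
  edges of the hull of \<open>Q\<close>; this is where the non-strict notion matters.\<close>

lemma convex_position_limit:
  fixes g :: "nat \<Rightarrow> real^2 \<Rightarrow> real^2"
  assumes lim: "\<And>x. x \<in> Q \<Longrightarrow> (\<lambda>n. g n x) \<longlonglongrightarrow> x"
    and freq: "\<exists>\<^sub>F n in sequentially. convex_position (g n ` Q)"
  shows "convex_position Q"
  unfolding convex_position_iff_support
proof
  fix q assume q: "q \<in> Q"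
  have "\<exists>m\<ge>n. \<exists>u. norm u = 1 \<and> (\<forall>x\<in>Q. u \<bullet> g m x \<le> u \<bullet> g m q)" for n
  proof -
    obtain m where "m \<ge> n" "convex_position (g m ` Q)"
      using freq by (auto simp: frequently_sequentially)
    with q show ?thesis
      unfolding convex_position_iff_support by blast
  qed
  then obtain m u where m: "\<And>n. m n \<ge> n" and u: "\<And>n. norm (u n) = 1"
    and le: "\<And>n x. x \<in> Q \<Longrightarrow> u n \<bullet> g (m n) x \<le> u n \<bullet> g (m n) q"
    by metis
  have "\<forall>n. u n \<in> sphere 0 1"
    using u by simp
  then obtain l r where l: "l \<in> sphere (0::real^2) 1" and r: "strict_mono r"
    and ul: "(u \<circ> r) \<longlonglongrightarrow> l"
    using compact_sphere[unfolded compact_def] by metis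
  have ul': "(\<lambda>n. u (r n)) \<longlonglongrightarrow> l"
    using ul by (simp add: o_def)
  \<comment> \<open>Although \<open>m\<close> may fail to be monotone,
    \<open>n \<le> r n \<le> m (r n)\<close> drives the indices to infinity.\<close>
  have "filterlim (\<lambda>n. m (r n)) sequentially sequentially"
    by (rule filterlim_at_top_mono[OF filterlim_ident]) (intro always_eventually allI order_trans[OF seq_suble[OF r] m])
  then have inner_lim: "(\<lambda>n. u (r n) \<bullet> g (m (r n)) x) \<longlonglongrightarrow> l \<bullet> x" if "x \<in> Q" for x
    by (intro tendsto_inner ul' filterlim_compose[OF lim[OF that]])
  have "l \<bullet> x \<le> l \<bullet> q" if "x \<in> Q" for x
    using LIMSEQ_le[OF inner_lim[OF that] inner_lim[OF q]] le[OF that] by blast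
  then show "\<exists>u. norm u = 1 \<and> (\<forall>x\<in>Q. u \<bullet> x \<le> u \<bullet> q)"
    using l by auto
qed

section \<open>Orientation and perturbation into general position\<close>

text \<open>Twice the signed area of the triangle, positive when it runs counterclockwise.\<close>

definition orient :: "real^2 \<Rightarrow> real^2 \<Rightarrow> real^2 \<Rightarrow> real" where
  "orient a b c = (b$1 - a$1) * (c$2 - a$2) - (b$2 - a$2) * (c$1 - a$1)"

lemma collinear_imp_orient_eq_0:
  assumes "collinear {a, b, c}"
  shows "orient a b c = 0"
proof -
  obtain u s t where "b - a = s *\<^sub>R u" "c - a = t *\<^sub>R u"
    using assms unfolding collinear_def by blast
  then have "b = a + s *\<^sub>R u" "c = a + t *\<^sub>R u"
    by (simp_all add: algebra_simps)
  then show ?thesis by (simp add: orient_def)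
qed

text \<open>While each \<open>x\<close> in \<open>P\<close> moves along
  \<open>x + s *\<^sub>R w x\<close>, a coincidence of two points or a collinearity of three forces
  \<open>s\<close> to be a root of a nonzero polynomial. Hence only finitely many \<open>s\<close>
  are bad.\<close>

lemma ex_general_position_sequence:
  fixes P :: "(real^2) set"
  assumes "finite P"
  obtains g :: "nat \<Rightarrow> real^2 \<Rightarrow> real^2"
  where "\<And>x. (\<lambda>n. g n x) \<longlonglongrightarrow> x"
    and "\<forall>\<^sub>F n in sequentially. inj_on (g n) P \<and> general_position (g n ` P)"
proof -
  obtain f0 :: "real^2 \<Rightarrow> nat" where "inj_on f0 P"
    using finite_imp_inj_to_nat_seg[OF assms] by blast
  define f where "f x = real (f0 x)" for x
  have f: "f x \<noteq> f y" if "x \<in> P" "y \<in> P" "x \<noteq> y" for x y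
    using \<open>inj_on f0 P\<close> that by (auto simp: f_def inj_on_def)
  \<comment> \<open>Distinct labels \<open>f x\<close> give distinct points of the parabola, no
    three of them collinear.\<close>
  define w :: "real^2 \<Rightarrow> real^2" where "w x = vector [f x, (f x)\<^sup>2]" for x
  define h where "h s x = x + s *\<^sub>R w x" for s x
  define T2 where "T2 x y = {s. h s x = h s y}" for x y
  define T3 where "T3 x y z = {s. orient (h s x) (h s y) (h s z) = 0}" for x y z
  have T2: "finite (T2 x y)" if "x \<in> P" "y \<in> P" "x \<noteq> y" for x y
  proof -
    \<comment> \<open>Comparing first coordinates leaves at most one \<open>s\<close>.\<close>
    have "s = (y$1 - x$1) / (f x - f y)" if "s \<in> T2 x y" for s
    proof -
      have "(h s x)$1 = (h s y)$1"
        using that by (simp add: T2_def)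
      then show ?thesis
        using f[OF \<open>x \<in> P\<close> \<open>y \<in> P\<close> \<open>x \<noteq> y\<close>] by (simp add: h_def w_def field_simps)
    qed
    then have "T2 x y \<subseteq> {(y$1 - x$1) / (f x - f y)}" by blast
    then show ?thesis by (rule finite_subset) simp
  qed
  have T3: "finite (T3 x y z)" if "x \<in> P" "y \<in> P" "z \<in> P" "x \<noteq> y" "x \<noteq> z" "y \<noteq> z" for x y z
  proof -
    \<comment> \<open>The leading coefficient is the orientation of three points of a parabola, a Vandermonde
      determinant.\<close>
    define p where "p = [:orient x y z,
      (y$1 - x$1) * (w z$2 - w x$2) + (w y$1 - w x$1) * (z$2 - x$2)
        - (y$2 - x$2) * (w z$1 - w x$1) - (w y$2 - w x$2) * (z$1 - x$1),
      (f y - f x) * (f z - f x) * (f z - f y):]"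
    have "orient (h s x) (h s y) (h s z) = poly p s" for s
      by (simp add: p_def orient_def h_def w_def algebra_simps power2_eq_square)
    moreover have "p \<noteq> 0"
      using f that by (auto simp: p_def)
    ultimately show ?thesis
      using poly_roots_finite[of p] by (simp add: T3_def)
  qed
  define T where "T = (\<Union>x\<in>P. \<Union>y\<in>P - {x}. T2 x y \<union> (\<Union>z\<in>P - {x, y}. T3 x y z))"
  have "finite T"
    unfolding T_def using assms by (auto intro!: T2 T3)
  define t where "t n = inverse (real (Suc n))" for n
  \<comment> \<open>An injective sequence meets the finite set \<open>T\<close> only finitely
    often.\<close>
  have "inj t"
    by (auto simp: t_def inj_def)
  then have "finite {n. t n \<in> T}"
    using finite_vimageI[OF \<open>finite T\<close>] by (simp add: vimage_def)
  then have ev: "\<forall>\<^sub>F n in sequentially. t n \<notin> T"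
    by (simp flip: cofinite_eq_sequentially add: eventually_cofinite)
  have good: "inj_on (h s) P \<and> general_position (h s ` P)" if "s \<notin> T" for s
  proof
    show "inj_on (h s) P"
      using that unfolding T_def T2_def inj_on_def by blast
    show "general_position (h s ` P)"
      unfolding general_position_def
    proof (clarsimp)
      fix x y z
      assume "x \<in> P" "y \<in> P" "z \<in> P" "h s x \<noteq> h s y" "h s x \<noteq> h s z" "h s y \<noteq> h s z"
        and col: "collinear {h s x, h s y, h s z}"
      then have "x \<in> P" "y \<in> P - {x}" "z \<in> P - {x, y}" by auto
      moreover have "s \<in> T3 x y z"
        using collinear_imp_orient_eq_0[OF col] by (simp add: T3_def)
      ultimately have "s \<in> T" unfolding T_def by blast
      with that show False by blast
    qed
  qed
  show thesis
  proof
    show "(\<lambda>n. h (t n) x) \<longlonglongrightarrow> x" for x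
    proof -
      have "t \<longlonglongrightarrow> 0"
        unfolding t_def by (rule LIMSEQ_inverse_real_of_nat)
      then have "(\<lambda>n. x + t n *\<^sub>R w x) \<longlonglongrightarrow> x + 0 *\<^sub>R w x"
        by (intro tendsto_intros)
      then show ?thesis by (simp add: h_def)
    qed
    show "\<forall>\<^sub>F n in sequentially. inj_on (h (t n)) P \<and> general_position (h (t n) ` P)"
      using ev by eventually_elim (rule good)
  qed
qed

section \<open>Convex position from orientations of constant sign\<close>

lemma orient_rotate: "orient b c a = orient a b c"
  by (simp add: orient_def algebra_simps)

text \<open>The normal is \<open>b - a\<close> turned clockwise by a right angle and scaled by
  \<open>s\<close>, whose sign tells on which side of the line through \<open>a\<close> and
  \<open>b\<close> the set \<open>Q\<close> lies.\<close>

lemma orient_support: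
  assumes "s \<noteq> 0" "a \<noteq> b" "\<And>c. c \<in> Q \<Longrightarrow> s * orient a b c \<ge> 0"
  shows "\<exists>u. u \<noteq> 0 \<and> (\<forall>x\<in>Q. u \<bullet> x \<le> u \<bullet> a)"
proof -
  define u :: "real^2" where "u = vector [s * (b$2 - a$2), - s * (b$1 - a$1)]"
  have "u \<bullet> a - u \<bullet> x = s * orient a b x" for x
    by (simp add: u_def orient_def inner_vec_def sum_2 algebra_simps)
  then have "\<forall>x\<in>Q. u \<bullet> x \<le> u \<bullet> a"
    using assms(3) by (metis diff_ge_0_iff_ge)
  moreover have "u \<noteq> 0"
    using assms(1,2) by (auto simp: u_def vec_eq_iff forall_2)
  ultimately show ?thesis by blast
qed

text \<open>The indexing need not be geometric: if all increasing triples have the same orientation, the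
  points occur in cyclic order, and each point and its cyclic successor span a supporting line.\<close>

lemma convex_position_if_monochromatic:
  fixes p :: "nat \<Rightarrow> real^2"
  assumes fin: "finite H" and inj: "inj_on p H" and s: "s \<noteq> 0"
    and mono: "\<And>i j k. \<lbrakk>i \<in> H; j \<in> H; k \<in> H; i < j; j < k\<rbrakk> \<Longrightarrow> s * orient (p i) (p j) (p k) \<ge> 0"
  shows "convex_position (p ` H)"
proof (rule convex_positionI)
  fix q assume "q \<in> p ` H"
  then obtain j where j: "j \<in> H" and q: "q = p j" by blast
  \<comment> \<open>It remains to choose \<open>k\<close> so that the line through
    \<open>p j\<close> and \<open>p k\<close> has all points on one side; for \<open>i = j\<close>
    and \<open>i = k\<close> the orientation vanishes.\<close>
  have *: "\<exists>u. u \<noteq> 0 \<and> (\<forall>x\<in>p ` H. u \<bullet> x \<le> u \<bullet> q)"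
    if k: "k \<in> H" "k \<noteq> j"
      and ge: "\<And>i. \<lbrakk>i \<in> H; i \<noteq> j; i \<noteq> k\<rbrakk> \<Longrightarrow> s * orient (p j) (p k) (p i) \<ge> 0" for k
  proof (rule orient_support[OF s])
    show "q \<noteq> p k"
      using inj j k by (auto simp: q inj_on_def)
    show "s * orient q (p k) c \<ge> 0" if c: "c \<in> p ` H" for c
    proof -
      obtain i where i: "i \<in> H" "c = p i" using c by blast
      consider "i = j" | "i = k" | "i \<noteq> j" "i \<noteq> k" by blast
      then show ?thesis
        using i ge[of i] by cases (auto simp: q orient_def)
    qed
  qed
  show "\<exists>u. u \<noteq> 0 \<and> (\<forall>x\<in>p ` H. u \<bullet> x \<le> u \<bullet> q)"
  proof (cases "\<exists>k\<in>H. k > j")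
    case True
    \<comment> \<open>With \<open>k\<close> the next index after \<open>j\<close>, any other
      \<open>i\<close> lies before \<open>j\<close> or after \<open>k\<close>, and either way
      \<open>j, k, i\<close> is a rotation of an increasing triple.\<close>
    define k where "k = Min {k \<in> H. k > j}"
    have k: "k \<in> H" "k > j"
      using Min_in[of "{k \<in> H. k > j}"] True fin unfolding k_def by fastforce+
    have next_index: "k \<le> i" if "i \<in> H" "i > j" for i
      using that fin by (auto simp: k_def intro!: Min_le)
    show ?thesis
    proof (rule *[OF k(1)])
      show "k \<noteq> j" using k by simp
      fix i assume i: "i \<in> H" "i \<noteq> j" "i \<noteq> k"
      then consider "i < j" | "k < i"
        using next_index[of i] by linarith
      then show "s * orient (p j) (p k) (p i) \<ge> 0"
        using mono[of i j k] mono[of j k i] i j k by cases (auto simp: orient_rotate)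
    qed
  next
    case False
    \<comment> \<open>Here \<open>j\<close> is the last index, so its cyclic successor is the first
      one and every other index lies between the two.\<close>
    define k where "k = Min H"
    have k: "k \<in> H" "\<And>i. i \<in> H \<Longrightarrow> k \<le> i"
      using j fin by (auto simp: k_def intro!: Min_in)
    show ?thesis
    proof (cases "k = j")
      case True
      have "H = {j}"
        using False True k(2) j by force
      \<comment> \<open>For a single point any nonzero vector serves as normal.\<close>
      then show ?thesis
        by (auto simp: q intro: exI[of _ "axis 1 1"])
    next
      case kj: False
      show ?thesis
      proof (rule *[OF k(1) kj])
        fix i assume i: "i \<in> H" "i \<noteq> j" "i \<noteq> k"
        then have "k < i" "i < j"
          using k(2)[of i] False by force+
        then show "s * orient (p j) (p k) (p i) \<ge> 0"
          using mono[of k i j] i j k by (auto simp: orient_rotate)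
      qed
    qed
  qed
qed

section \<open>Ramsey's theorem and attainment of the minimum\<close>

text \<open>Lets a colouring of three-element sets read off the orientation of the increasing
  listing unambiguously.\<close>

lemma increasing_triple_unique:
  fixes i j k i' j' k' :: "'a::linorder"
  assumes "{i, j, k} = {i', j', k'}" "i < j" "j < k" "i' < j'" "j' < k'"
  shows "i = i' \<and> j = j' \<and> k = k'"
proof -
  have "sorted_list_of_set {i, j, k} = [i, j, k]"
    by (rule sorted_list_of_set_unique[THEN iffD1]) (use assms(2,3) in \<open>auto simp: card_insert_if\<close>)
  moreover have "sorted_list_of_set {i', j', k'} = [i', j', k']"
    by (rule sorted_list_of_set_unique[THEN iffD1]) (use assms(4,5) in \<open>auto simp: card_insert_if\<close>)
  ultimately have "[i, j, k] = [i', j', k']"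
    using assms(1) by metis
  then show ?thesis by simp
qed

lemma erdos_szekeres_exists:
  obtains N where "\<And>P. finite P \<Longrightarrow> card P \<ge> N \<Longrightarrow> contains_convex k P"
proof -
  \<comment> \<open>Both colours ask for the same size, so either outcome is good; a negative
    \<open>k\<close> becomes \<open>0\<close>.\<close>
  obtain N :: nat where N: "partn_lst {..<N} [nat k, nat k] 3"
    using ramsey2_full by blast
  show thesis
  proof
    fix P :: "(real^2) set" assume P: "finite P" "card P \<ge> N"
    obtain p where p: "bij_betw p {..<card P} P"
      using ex_bij_betw_nat_finite[OF P(1)] by (auto simp: atLeast0LessThan)
    \<comment> \<open>Colour \<open>0\<close> means nonnegative orientation, so collinear triples
      receive it too.\<close>
    define c :: "nat set \<Rightarrow> nat" where
      "c S = (if \<exists>i j k. i < j \<and> j < k \<and> S = {i, j, k} \<and> orient (p i) (p j) (p k) \<ge> 0 then 0 else 1)"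
      for S
    have "c \<in> nsets {..<N} 3 \<rightarrow> {..<2}"
      by (auto simp: c_def)
    then obtain e H where e: "e < length [nat k, nat k]" and H: "H \<in> nsets {..<N} ([nat k, nat k] ! e)"
      and mono: "c ` nsets H 3 \<subseteq> {e}"
      using partn_lstE[OF N, of c 2] by auto
    from H e have H: "H \<subseteq> {..<card P}" "finite H" "card H = nat k"
      using P(2) by (auto simp: nsets_def less_Suc_eq)
    have inj: "inj_on p H"
      using p H(1) by (meson bij_betw_def inj_on_subset)
    have col: "c {i, j, l} = e" if "i \<in> H" "j \<in> H" "l \<in> H" "i < j" "j < l" for i j l
      using mono that by (auto simp: nsets_3_eq image_subset_iff)
    have pos: "c {i, j, l} = 0 \<longleftrightarrow> orient (p i) (p j) (p l) \<ge> 0" if "i < j" "j < l" for i j l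
    proof -
      have "(\<exists>i' j' l'. i' < j' \<and> j' < l' \<and> {i, j, l} = {i', j', l'}
          \<and> orient (p i') (p j') (p l') \<ge> 0) \<longleftrightarrow> orient (p i) (p j) (p l) \<ge> 0"
        using that increasing_triple_unique[OF _ that] by metis
      then show ?thesis by (simp add: c_def)
    qed
    have "convex_position (p ` H)"
    proof (rule convex_position_if_monochromatic[OF H(2) inj])
      \<comment> \<open>The sign turns the negative orientations of colour \<open>1\<close> into
        positive ones.\<close>
      show "(if e = 0 then 1 else - 1 :: real) \<noteq> 0" by simp
      show "0 \<le> (if e = 0 then 1 else - 1) * orient (p i) (p j) (p l)"
        if "i \<in> H" "j \<in> H" "l \<in> H" "i < j" "j < l" for i j l
        using col[OF that] pos[OF that(4,5)] by auto
    qed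
    moreover have "p ` H \<subseteq> P"
      using p H(1) by (auto simp: bij_betw_def)
    moreover have "int (card (p ` H)) \<ge> k"
      using H(3) by (simp add: card_image[OF inj])
    ultimately show "contains_convex k P"
      unfolding contains_convex_def by blast
  qed
qed

text \<open>The \<open>LEAST\<close> in \<open>ES\<close> has its defining property once some number
  has it, and the Ramsey bound is such a number.\<close>

lemma contains_convex_general_position:
  assumes "finite P" "general_position P" "card P \<ge> ES k"
  shows "contains_convex k P"
proof -
  obtain N where "\<And>P. finite P \<Longrightarrow> card P \<ge> N \<Longrightarrow> contains_convex k P"
    using erdos_szekeres_exists by blast
  then have "\<forall>P. finite P \<and> general_position P \<and> card P \<ge> N \<longrightarrow> contains_convex k P"
    by blast
  then have "\<forall>P. finite P \<and> general_position P \<and> card P \<ge> ES k \<longrightarrow> contains_convex k P"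
    unfolding ES_def by (rule LeastI)
  with assms show ?thesis by blast
qed

section \<open>From general position to arbitrary finite sets\<close>

theorem theorem1:
  fixes k :: int and P :: "(real^2) set"
  assumes "finite P" and "card P \<ge> ES k"
  shows "contains_convex k P"
proof -
  obtain g where lim: "\<And>x. (\<lambda>n. g n x) \<longlonglongrightarrow> x"
    and ev: "\<forall>\<^sub>F n in sequentially. inj_on (g n) P \<and> general_position (g n ` P)"
    using ex_general_position_sequence[OF assms(1)] by blast
  have "\<forall>\<^sub>F n in sequentially. \<exists>Q\<in>Pow P. int (card Q) \<ge> k \<and> convex_position (g n ` Q)"
    using ev
  proof eventually_elim
    case (elim n)
    \<comment> \<open>Injectivity keeps the image as large as \<open>P\<close>, hence of size at
      least \<open>ES k\<close>.\<close>
    then have "contains_convex k (g n ` P)"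
      using assms by (intro contains_convex_general_position) (auto simp: card_image)
    then obtain R where R: "R \<subseteq> g n ` P" "int (card R) \<ge> k" "convex_position R"
      unfolding contains_convex_def by blast
    then obtain Q where Q: "Q \<subseteq> P" "R = g n ` Q"
      by (meson subset_image_iff)
    with elim have "card R = card Q"
      by (auto intro: card_image inj_on_subset)
    with Q R show ?case by auto
  qed
  then have "\<exists>\<^sub>F n in sequentially. \<exists>Q\<in>Pow P. int (card Q) \<ge> k \<and> convex_position (g n ` Q)"
    by (simp add: eventually_frequently)
  \<comment> \<open>Pigeonhole: \<open>Q\<close> depended on \<open>n\<close>, but \<open>P\<close>
    has finitely many subsets, so one of them recurs infinitely often.\<close>
  then have "\<exists>Q\<in>Pow P. \<exists>\<^sub>F n in sequentially. int (card Q) \<ge> k \<and> convex_position (g n ` Q)"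
    using assms(1) by (intro frequently_bex_finite) auto
  then obtain Q where "Q \<subseteq> P"
    and *: "\<exists>\<^sub>F n in sequentially. int (card Q) \<ge> k \<and> convex_position (g n ` Q)"
    by blast
  have freq: "\<exists>\<^sub>F n in sequentially. convex_position (g n ` Q)"
    using * by (rule frequently_elim1) simp
  \<comment> \<open>The size bound does not involve \<open>n\<close>, so a single good
    \<open>n\<close> yields it.\<close>
  have Q: "Q \<subseteq> P" "int (card Q) \<ge> k"
    using \<open>Q \<subseteq> P\<close> frequently_ex[OF *] by auto
  have "convex_position Q"
    by (rule convex_position_limit[OF lim freq])
  with Q show ?thesis
    unfolding contains_convex_def by blast
qed

end
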